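(* Let $n\ge 3$ and let $G$ be the transitive permutation group arising from $\mathrm{PSL}(2,3^n)$ acting on the left cosets of a subgroup of order $3$. Then $\rho(G)=3^{n-1}$ if $n$ is odd, and $\rho(G)=3^{n/2-1}$ if $n$ is even.
   Context: For a permutation group $G$ on a finite set $V$, a subset $\mathcal{F}\subseteq G$ is intersecting if for all $g,h\in\mathcal{F}$ there is $v\in V$ with $g(v)=h(v)$. The intersection density $\rho(G)$ is the maximum of $|\mathcal{F}|/\max\{|G_v|: v\in V\}$ over all intersecting sets $\mathcal{F}$ of $G$, where $G_v$ is the stabilizer of $v$. *)

theory Defs
  imports Complex_Main "HOL-Library.Cardinality"
begin

definition intersecting :: "'v set \<Rightarrow> ('v \<Rightarrow> 'v) set \<Rightarrow> bool" where
  "intersecting V F \<longleftrightarrow> (\<forall>g\<in>F. \<forall>h\<in>F. \<exists>v\<in>V. g v = h v)"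

definition stabilizer :: "('v \<Rightarrow> 'v) set \<Rightarrow> 'v \<Rightarrow> ('v \<Rightarrow> 'v) set" where
  "stabilizer G v = {g\<in>G. g v = v}"

definition intersection_density :: "('v \<Rightarrow> 'v) set \<Rightarrow> 'v set \<Rightarrow> real" where
  "intersection_density G V =
     Max {real (card F) / real (Max ((\<lambda>v. card (stabilizer G v)) ` V)) | F. F \<subseteq> G \<and> intersecting V F}"

type_synonym 'a mat2 = "'a \<times> 'a \<times> 'a \<times> 'a"  (* (a,b,c,d) = [[a,b],[c,d]] *)

fun mmul :: "'a::comm_ring_1 mat2 \<Rightarrow> 'a mat2 \<Rightarrow> 'a mat2" where
  "mmul (a, b, c, d) (e, f, g, h) = (a*e + b*g, a*f + b*h, c*e + d*g, c*f + d*h)"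

fun mneg :: "'a::comm_ring_1 mat2 \<Rightarrow> 'a mat2" where
  "mneg (a, b, c, d) = (-a, -b, -c, -d)"

definition SL2 :: "'a::comm_ring_1 mat2 set" where
  "SL2 = {(a, b, c, d). a*d - b*c = 1}"

definition PSL2 :: "'a::comm_ring_1 mat2 set set" where
  "PSL2 = (\<lambda>M. {M, mneg M}) ` SL2"

definition pmul :: "'a::comm_ring_1 mat2 set \<Rightarrow> 'a mat2 set \<Rightarrow> 'a mat2 set" where
  "pmul X Y = {mmul M N | M N. M \<in> X \<and> N \<in> Y}"

definition pone :: "'a::comm_ring_1 mat2 set" where
  "pone = {(1, 0, 0, 1), (-1, 0, 0, -1)}"

text \<open>Subgroups of PSL(2,F) (for finite F, closure under products of a set
  containing the identity gives a subgroup).\<close>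

definition PSL2_subgroup :: "'a::comm_ring_1 mat2 set set \<Rightarrow> bool" where
  "PSL2_subgroup H \<longleftrightarrow> H \<subseteq> PSL2 \<and> pone \<in> H \<and> (\<forall>x\<in>H. \<forall>y\<in>H. pmul x y \<in> H)"

definition left_cosets :: "'a::comm_ring_1 mat2 set set \<Rightarrow> 'a mat2 set set set" where
  "left_cosets H = {pmul g ` H | g. g \<in> PSL2}"

definition coset_perm :: "'a::comm_ring_1 mat2 set set \<Rightarrow> 'a mat2 set
    \<Rightarrow> 'a mat2 set set \<Rightarrow> 'a mat2 set set" where
  "coset_perm H g C = (if C \<in> left_cosets H then pmul g ` C else C)"

definition coset_action_group :: "'a::comm_ring_1 mat2 set set \<Rightarrow> ('a mat2 set set \<Rightarrow> 'a mat2 set set) set" where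
  "coset_action_group H = coset_perm H ` PSL2"

end

theory Submission
  imports Defs "HOL-Computational_Algebra.Computational_Algebra"
begin

text \<open>
  Let \<open>q = 3\<^sup>n\<close>. An element of \<open>PSL(2,q)\<close> fixes a coset of \<open>H\<close> iff, up to sign, it is
  unipotent of the form \<open>1 \<plusminus> s v v\<^sup>T J\<close>, where \<open>s\<close> is determined by \<open>H\<close> modulo squares.
  An intersecting set can be translated to contain the identity and lifted to unipotent matrices
  \<open>1 + E\<^sub>i\<close>; the trace condition on quotients becomes \<open>tr (E\<^sub>i E\<^sub>j) \<in> {0, 1}\<close>, with value \<open>0\<close> iff
  \<open>E\<^sub>i\<close> and \<open>E\<^sub>j\<close> are proportional. Hence if two different nonzero \<open>E\<^sub>i\<close> are proportional, then all are;
  otherwise all values are \<open>1\<close>, and nondegeneracy of the trace form on the three-dimensional space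
  of traceless matrices leaves at most four nonzero \<open>E\<^sub>i\<close>. In the proportional case the set lies in
  a coset of a Sylow 3-subgroup. For odd \<open>n\<close> the whole Sylow subgroup is intersecting because \<open>-1\<close>
  is not a square. For even \<open>n\<close> the parameters form a set whose differences are squares, that is,
  a clique of the Paley graph, and the maximum size \<open>\<surd>q\<close> is attained by the subfield of order \<open>\<surd>q\<close>.
\<close>

subsection \<open>Squares in finite fields\<close>

text \<open>Multiplication by a nonzero \<open>x\<close> permutes the nonzero elements, so their
  product absorbs the factor \<open>x ^ (CARD('a) - 1)\<close>.\<close>

lemma power_CARD_eq_same:
  fixes x :: "'a::{field,finite}"
  shows "x ^ CARD('a) = x"
proof (cases "x = 0")
  case False
  have "(\<Prod>y\<in>UNIV-{0}. y) = (\<Prod>y\<in>UNIV-{0}. x * y)"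
    by (rule prod.reindex_bij_witness[of _ "\<lambda>y. x * y" "\<lambda>y. y / x"]) (use False in auto)
  also have "\<dots> = x ^ (CARD('a) - 1) * \<Prod>(UNIV-{0})"
    by (simp add: prod.distrib)
  finally have "x ^ (CARD('a) - 1) = 1"
    by simp
  moreover have "CARD('a) = Suc (CARD('a) - 1)"
    by simp
  ultimately show ?thesis
    by (metis mult.right_neutral power_Suc)
qed simp

lemma of_nat_CARD_eq_0: "of_nat CARD('a) = (0 :: 'a::{ring_1,finite})"
proof -
  have "(\<Sum>y\<in>UNIV. y) = (\<Sum>y\<in>UNIV. y + (1::'a))"
    by (rule sum.reindex_bij_witness[of _ "\<lambda>y. y + 1" "\<lambda>y. y - 1"]) auto
  also have "\<dots> = (\<Sum>y\<in>UNIV. y) + of_nat CARD('a)"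
    by (simp add: sum.distrib)
  finally show ?thesis
    by simp
qed

lemma three_eq_0:
  assumes "CARD('a::{field,finite}) = 3 ^ n"
  shows "(3::'a) = 0"
  using of_nat_CARD_eq_0[where 'a='a] assms by simp

lemma two_eq_minus_1:
  assumes "CARD('a::{field,finite}) = 3 ^ n"
  shows "(2::'a) = - 1"
  using three_eq_0[OF assms] by (simp add: eq_neg_iff_add_eq_0)

lemma card_le_mult_card_image:
  assumes "finite A" and "\<And>y. y \<in> f ` A \<Longrightarrow> card {x \<in> A. f x = y} \<le> k"
  shows "card A \<le> k * card (f ` A)"
proof -
  have "(\<Union>y\<in>f ` A. {x \<in> A. f x = y}) = A"
    by auto
  then have "card A \<le> (\<Sum>y\<in>f ` A. card {x \<in> A. f x = y})"
    using card_UN_le[of "f ` A" "\<lambda>y. {x \<in> A. f x = y}"] assms(1) by simp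
  also have "\<dots> \<le> (\<Sum>y\<in>f ` A. k)"
    by (rule sum_mono) (use assms in auto)
  finally show ?thesis
    by (simp add: mult.commute)
qed

lemma card_power_eq_le:
  fixes a :: "'a::idom"
  assumes "k > 0"
  shows "card {x. x ^ k = a} \<le> k"
proof -
  let ?p = "monom 1 k + [:- a:] :: 'a poly"
  have deg: "degree ?p = k"
    using assms by (subst degree_add_eq_left) (auto simp: degree_monom_eq)
  then have "?p \<noteq> 0"
    using assms by force
  then have "card {x. poly ?p x = 0} \<le> k"
    using card_poly_roots_bound deg by metis
  then show ?thesis
    by (simp add: poly_monom)
qed

definition is_sqr :: "'a::monoid_mult \<Rightarrow> bool" where
  "is_sqr x \<longleftrightarrow> (\<exists>y. x = y ^ 2)"

lemma is_sqr_mult: "is_sqr x \<Longrightarrow> is_sqr y \<Longrightarrow> is_sqr (x * y)" for x :: "'a::comm_monoid_mult"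
  unfolding is_sqr_def by (metis power_mult_distrib)

lemma is_sqr_divide: "is_sqr x \<Longrightarrow> is_sqr y \<Longrightarrow> is_sqr (x / y)" for x :: "'a::field"
  unfolding is_sqr_def by (metis power_divide)

text \<open>Squaring is at most two-to-one, so at least half of the nonzero elements are squares. As
  \<open>t\<close> is a nonsquare, the nonzero squares and their quotients by \<open>t\<close> are
  disjoint, and together they leave no room for a further nonzero \<open>y\<close>.\<close>

lemma is_sqr_or_is_sqr_mult:
  fixes t y :: "'a::{field,finite}"
  assumes t: "\<not> is_sqr t"
  shows "is_sqr y \<or> is_sqr (t * y)"
proof (rule ccontr)
  assume neg: "\<not> (is_sqr y \<or> is_sqr (t * y))"
  let ?N = "UNIV - {0::'a}"
  let ?Q = "(\<lambda>x. x ^ 2) ` ?N"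
  have t0: "t \<noteq> 0" and y0: "y \<noteq> 0"
    using t neg unfolding is_sqr_def by (metis zero_power2)+
  have le: "card ?N \<le> 2 * card ?Q"
  proof (rule card_le_mult_card_image)
    fix a :: 'a
    have "card {x \<in> ?N. x ^ 2 = a} \<le> card {x. x ^ 2 = a}"
      by (rule card_mono) auto
    also have "\<dots> \<le> 2"
      by (rule card_power_eq_le) simp
    finally show "card {x \<in> ?N. x ^ 2 = a} \<le> 2" .
  qed simp
  have disj: "?Q \<inter> (\<lambda>z. z / t) ` ?Q = {}"
  proof (rule ccontr)
    assume "?Q \<inter> (\<lambda>z. z / t) ` ?Q \<noteq> {}"
    then obtain u v where "u \<noteq> 0" "u ^ 2 = v ^ 2 / t"
      by auto
    then have "t = (v / u) ^ 2"
      using t0 by (simp add: field_simps)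
    then show False
      using t unfolding is_sqr_def by blast
  qed
  have "y \<notin> (\<lambda>z. z / t) ` ?Q"
    using neg t0 unfolding is_sqr_def by auto
  moreover have "y \<notin> ?Q"
    using neg unfolding is_sqr_def by auto
  ultimately have "?Q \<union> (\<lambda>z. z / t) ` ?Q \<subseteq> ?N - {y}"
    using t0 by auto
  then have "card (?Q \<union> (\<lambda>z. z / t) ` ?Q) \<le> card (?N - {y})"
    by (rule card_mono[rotated]) simp
  moreover have "card (?Q \<union> (\<lambda>z. z / t) ` ?Q) = card ?Q + card ((\<lambda>z. z / t) ` ?Q)"
    by (rule card_Un_disjoint) (use disj in auto)
  moreover have "card ((\<lambda>z. z / t) ` ?Q) = card ?Q"
    by (rule card_image) (use t0 in \<open>auto simp: inj_on_def\<close>)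
  moreover have "card (?N - {y}) < card ?N"
    using y0 by (intro psubset_card_mono) auto
  ultimately show False
    using le by linarith
qed

text \<open>On a finite field a surjective squaring map would be injective, but 1 and -1 have the
  same square.\<close>

lemma ex_nonsquare:
  assumes "(2::'a::{field,finite}) \<noteq> 0"
  shows "\<exists>t::'a. \<not> is_sqr t"
proof (rule ccontr)
  assume "\<nexists>t::'a. \<not> is_sqr t"
  then have "surj (\<lambda>y::'a. y ^ 2)"
    unfolding is_sqr_def surj_def by blast
  then have "inj (\<lambda>y::'a. y ^ 2)"
    by (simp add: finite_UNIV_surj_inj)
  then have "(1::'a) = - 1"
    by (rule injD) simp
  then show False
    using assms by (metis add.right_inverse one_add_one)
qed

text \<open>For odd \<open>n\<close> the order is 3 modulo 4, so a root \<open>i\<close> of -1 would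
  satisfy i = i^q = i^3 = -i.\<close>

lemma not_is_sqr_minus_1:
  assumes q: "CARD('a::{field,finite}) = 3 ^ n" and "odd n"
  shows "\<not> is_sqr (- 1 :: 'a)"
proof
  assume "is_sqr (- 1 :: 'a)"
  then obtain i :: 'a where i: "i ^ 2 = - 1"
    unfolding is_sqr_def by metis
  obtain m where n: "n = 2 * m + 1"
    using \<open>odd n\<close> oddE by blast
  have "(9::nat) ^ m mod 4 = 1"
    by (induction m) (auto simp: mod_mult_right_eq[of 9, symmetric])
  then have "CARD('a) mod 4 = 3"
    unfolding q n by (simp add: power_mult mod_mult_right_eq[of 3, symmetric])
  then obtain k where "CARD('a) = 4 * k + 3"
    by (metis mult_div_mod_eq)
  then have "i = i ^ (4 * k + 3)"
    using power_CARD_eq_same[of i] by simp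
  also have "\<dots> = ((i ^ 2) ^ 2) ^ k * i ^ 2 * i"
    by (simp add: power_add power_mult power3_eq_cube power2_eq_square power4_eq_xxxx mult.assoc)
  also have "\<dots> = - i"
    by (simp add: i)
  finally have "i + i = 0"
    using eq_neg_iff_add_eq_0 by blast
  then have "2 * i = 0"
    by (simp only: mult_2)
  moreover have "i \<noteq> 0"
    using i by auto
  ultimately have "(2::'a) = 0"
    by simp
  then show False
    using two_eq_minus_1[OF q] by simp
qed

text \<open>The elements \<open>z ^ (r + 1)\<close> are the norms to the subfield of order \<open>r\<close>; counting fibres
  shows that they fill the subfield, and they are squares because \<open>r + 1\<close> is even.\<close>

lemma square_subfield:
  assumes q: "CARD('a::{field,finite}) = 3 ^ n" and "even n" "n > 0"
  obtains K :: "'a::{field,finite} set" where "card K = 3 ^ (n div 2)" "- 1 \<in> K"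
    "\<And>x y. x \<in> K \<Longrightarrow> y \<in> K \<Longrightarrow> x - y \<in> K" "\<And>x. x \<in> K \<Longrightarrow> is_sqr x"
proof -
  define r :: nat where "r = 3 ^ (n div 2)"
  have "n div 2 > 0"
    using assms by auto
  then have odd: "odd r" and r1: "r > 1"
    unfolding r_def by (simp_all add: one_less_power del: One_nat_def)
  then have r0: "r > 0"
    by simp
  have qr: "CARD('a) = r * r"
    using \<open>even n\<close> unfolding q r_def by (metis dvd_mult_div_cancel mult_2 power_add)
  have frob: "(x + y) ^ r = x ^ r + y ^ r" for x y :: 'a
  proof -
    have "CHAR('a) dvd 3"
      using three_eq_0[OF q] of_nat_eq_0_iff_char_dvd[of 3, where 'a='a] by simp
    moreover have "prime (3::nat)"
      by simp
    ultimately have "CHAR('a) = 1 \<or> CHAR('a) = 3"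
      by (metis prime_nat_iff)
    then have "CHAR('a) = 3"
      by simp
    then show ?thesis
      by (intro freshmans_dream'[where m = r and n = "n div 2"]) (auto simp: r_def)
  qed
  define K where "K = {x::'a. x ^ r = x}"
  let ?N = "(\<lambda>z::'a. z ^ (r + 1)) ` (UNIV - {0})"
  have NK: "insert 0 ?N \<subseteq> K"
  proof
    fix x assume "x \<in> insert 0 ?N"
    then consider "x = 0" | z where "x = z ^ (r + 1)"
      by blast
    then show "x \<in> K"
    proof cases
      case 2
      have "x ^ r = z ^ CARD('a) * z ^ r"
        unfolding 2 qr power_mult[symmetric] power_add[symmetric] by (simp add: algebra_simps)
      then show ?thesis
        by (simp add: K_def power_CARD_eq_same 2)
    qed (use r0 in \<open>simp add: K_def\<close>)
  qed
  have "card (UNIV - {0::'a}) \<le> (r + 1) * card ?N"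
  proof (rule card_le_mult_card_image)
    fix a :: 'a
    have "card {x \<in> UNIV - {0}. x ^ (r + 1) = a} \<le> card {x. x ^ (r + 1) = a}"
      by (rule card_mono) auto
    also have "\<dots> \<le> r + 1"
      by (rule card_power_eq_le) simp
    finally show "card {x \<in> UNIV - {0}. x ^ (r + 1) = a} \<le> r + 1" .
  qed simp
  moreover have "card (UNIV - {0::'a}) = (r + 1) * (r - 1)"
    using r0 by (simp add: card_Diff_singleton qr algebra_simps diff_mult_distrib2)
  ultimately have "(r + 1) * (r - 1) \<le> (r + 1) * card ?N"
    by (simp only:)
  then have "r - 1 \<le> card ?N"
    by (rule mult_le_cancel1[THEN iffD1, rule_format]) simp
  moreover have "0 \<notin> ?N"
    by auto
  ultimately have ge: "r \<le> card (insert 0 ?N)"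
    using r0 by simp
  \<comment> \<open>Splitting off the root 0 brings x^r = x into the form to which
    \<open>card_power_eq_le\<close> applies.\<close>
  have "K \<subseteq> insert 0 {x. x ^ (r - 1) = 1}"
  proof
    fix x assume "x \<in> K"
    then have "x * x ^ (r - 1) = x"
      using r0 by (simp add: K_def flip: power_Suc)
    then show "x \<in> insert 0 {x. x ^ (r - 1) = 1}"
      by auto
  qed
  then have "card K \<le> card (insert 0 {x::'a. x ^ (r - 1) = 1})"
    by (rule card_mono[rotated]) simp
  also have "\<dots> \<le> r"
    using card_power_eq_le[of "r - 1" "1::'a"] r1 by (auto simp: card_insert_if)
  finally have le: "card K \<le> r" .
  have K_eq: "K = insert 0 ?N"
    using NK ge le by (intro card_seteq[symmetric]) auto
  show thesis
  proof (rule that[of K])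
    show "card K = 3 ^ (n div 2)"
      using le ge unfolding K_eq r_def by simp
    show "- 1 \<in> K"
      using odd by (simp add: K_def)
    have "(- y) ^ r = - y" if "y \<in> K" for y
      using that odd by (simp add: K_def)
    then show "x - y \<in> K" if "x \<in> K" "y \<in> K" for x y
      using that frob[of x "- y"] by (simp add: K_def)
    show "is_sqr x" if "x \<in> K" for x
    proof -
      obtain m where m: "r + 1 = m * 2"
        using odd by (metis Suc_eq_plus1 dvd_def even_Suc mult.commute)
      from that consider "x = 0 ^ 2" | z where "x = z ^ (m * 2)"
        unfolding K_eq m by auto
      then show ?thesis
        unfolding is_sqr_def power_mult by metis
    qed
  qed
qed

text \<open>For a nonsquare \<open>t\<close>, the pairs (a, b) from \<open>C\<close> have distinct
  values a + t b: a collision would make \<open>t\<close> a quotient of two differences, hence a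
  square.\<close>

lemma card_square_difference_clique:
  fixes C :: "'a::{field,finite} set"
  assumes "(2::'a) \<noteq> 0" and C: "\<And>a b. a \<in> C \<Longrightarrow> b \<in> C \<Longrightarrow> is_sqr (a - b)"
  shows "card C ^ 2 \<le> CARD('a)"
proof -
  obtain t :: 'a where t: "\<not> is_sqr t"
    using ex_nonsquare assms(1) by blast
  have "inj_on (\<lambda>(a, b). a + t * b) (C \<times> C)"
  proof (rule inj_onI, clarify)
    fix a b a' b' assume *: "a \<in> C" "b \<in> C" "a' \<in> C" "b' \<in> C" "a + t * b = a' + t * b'"
    then have eq: "a - a' = t * (b' - b)"
      by (simp add: algebra_simps)
    have "b' = b"
    proof (rule ccontr)
      assume "b' \<noteq> b"
      then have "t = (a - a') / (b' - b)"
        using eq by simp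
      then show False
        using t C * is_sqr_divide by metis
    qed
    then show "a = a' \<and> b = b'"
      using eq by simp
  qed
  then have "card (C \<times> C) \<le> CARD('a)"
    by (rule card_inj_on_le) auto
  then show ?thesis
    by (simp add: card_cartesian_product power2_eq_square)
qed

subsection \<open>Two by two matrices modulo sign\<close>

abbreviation mid :: "'a::comm_ring_1 mat2" where
  "mid \<equiv> (1, 0, 0, 1)"

text \<open>The adjugate: it inverts matrices of determinant 1, and it reverses products of
  arbitrary matrices.\<close>

fun minv :: "'a::comm_ring_1 mat2 \<Rightarrow> 'a mat2" where
  "minv (a, b, c, d) = (d, - b, - c, a)"

fun mtrace :: "'a::comm_ring_1 mat2 \<Rightarrow> 'a" where
  "mtrace (a, b, c, d) = a + d"

definition proj :: "'a::comm_ring_1 mat2 \<Rightarrow> 'a mat2 set" where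
  "proj M = {M, mneg M}"

lemma mmul_assoc: "mmul (mmul K M) N = mmul K (mmul M N)"
  by (cases K; cases M; cases N) (simp add: algebra_simps)

lemma mmul_mid [simp]: "mmul mid M = M" "mmul M mid = M"
  by (cases M; simp)+

lemma mmul_mneg [simp]: "mmul (mneg M) N = mneg (mmul M N)" "mmul M (mneg N) = mneg (mmul M N)"
  by (cases M; cases N; simp)+

lemma mneg_mneg [simp]: "mneg (mneg M) = M"
  by (cases M) simp

lemma mmul_minv [simp]: "M \<in> SL2 \<Longrightarrow> mmul M (minv M) = mid" "M \<in> SL2 \<Longrightarrow> mmul (minv M) M = mid"
  by (cases M; simp add: SL2_def algebra_simps)+

lemma mmul_minv_cancel [simp]:
  "M \<in> SL2 \<Longrightarrow> mmul M (mmul (minv M) N) = N" "M \<in> SL2 \<Longrightarrow> mmul (minv M) (mmul M N) = N"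
  by (simp_all flip: mmul_assoc)

lemma minv_mmul: "minv (mmul M N) = mmul (minv N) (minv M)"
  by (cases M; cases N) (simp add: algebra_simps)

lemma mid_in_SL2 [simp]: "mid \<in> SL2"
  by (simp add: SL2_def)

lemma mmul_in_SL2 [simp]: "M \<in> SL2 \<Longrightarrow> N \<in> SL2 \<Longrightarrow> mmul M N \<in> SL2"
proof (cases M, cases N)
  fix a b c d e f g h assume *: "M = (a, b, c, d)" "N = (e, f, g, h)" "M \<in> SL2" "N \<in> SL2"
  have "(a*e + b*g) * (c*f + d*h) - (a*f + b*h) * (c*e + d*g) = (a*d - b*c) * (e*h - f*g)"
    by (simp add: algebra_simps)
  then show "mmul M N \<in> SL2"
    using * by (simp add: SL2_def)
qed

lemma minv_in_SL2 [simp]: "M \<in> SL2 \<Longrightarrow> minv M \<in> SL2"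
  by (cases M) (simp add: SL2_def algebra_simps)

lemma proj_eq_iff: "proj M = proj N \<longleftrightarrow> M = N \<or> M = mneg N"
  by (auto simp: proj_def doubleton_eq_iff)

lemma proj_mneg [simp]: "proj (mneg M) = proj M"
  by (simp add: proj_eq_iff)

lemma pmul_proj [simp]: "pmul (proj M) (proj N) = proj (mmul M N)"
proof -
  have "pmul (proj M) (proj N) = {mmul M N, mmul M (mneg N), mmul (mneg M) N, mmul (mneg M) (mneg N)}"
    unfolding pmul_def proj_def by blast
  then show ?thesis
    unfolding proj_def by auto
qed

lemma proj_mmul_cong: "proj M = proj M' \<Longrightarrow> proj N = proj N' \<Longrightarrow> proj (mmul M N) = proj (mmul M' N')"
  by (metis pmul_proj)

lemma PSL2_eq: "PSL2 = proj ` SL2"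
  by (simp add: PSL2_def proj_def)

lemma pone_eq: "pone = proj mid"
  by (simp add: pone_def proj_def)

lemma left_cosets_eq: "left_cosets H = (\<lambda>X. pmul (proj X) ` H) ` SL2"
  by (auto simp: left_cosets_def PSL2_eq)

lemma pmul_proj_image:
  assumes "H \<subseteq> PSL2"
  shows "pmul (proj M) ` pmul (proj N) ` H = pmul (proj (mmul M N)) ` H"
  unfolding image_image
proof (rule image_cong)
  fix h assume "h \<in> H"
  then obtain K where "h = proj K"
    using assms unfolding PSL2_eq by blast
  then show "pmul (proj M) (pmul (proj N) h) = pmul (proj (mmul M N)) h"
    by (simp add: mmul_assoc)
qed simp

lemma coset_perm_proj:
  assumes "H \<subseteq> PSL2" "X \<in> SL2"
  shows "coset_perm H (proj M) (pmul (proj X) ` H) = pmul (proj (mmul M X)) ` H"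
  using assms by (simp add: coset_perm_def pmul_proj_image left_cosets_eq)

text \<open>For the converse, left multiplication by X^-1 Y maps \<open>H\<close> injectively into
  itself; \<open>H\<close> is finite, so the map is onto and the factor can be absorbed.\<close>

lemma coset_eq_iff:
  fixes H :: "'a::{comm_ring_1,finite} mat2 set set"
  assumes H: "PSL2_subgroup H" and XY: "X \<in> SL2" "Y \<in> SL2"
  shows "pmul (proj X) ` H = pmul (proj Y) ` H \<longleftrightarrow> proj (mmul (minv X) Y) \<in> H"
proof
  assume eq: "pmul (proj X) ` H = pmul (proj Y) ` H"
  have "proj mid \<in> H"
    using H by (simp add: PSL2_subgroup_def pone_eq)
  then have "pmul (proj Y) (proj mid) \<in> pmul (proj X) ` H"
    unfolding eq by (rule imageI)
  then obtain h where h: "h \<in> H" "proj Y = pmul (proj X) h"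
    by auto
  moreover obtain K where "h = proj K"
    using h(1) H unfolding PSL2_subgroup_def PSL2_eq by blast
  ultimately have "h = proj (mmul (minv X) Y)"
    using XY proj_mmul_cong[of "minv X" "minv X" Y "mmul X K"] by simp
  with h show "proj (mmul (minv X) Y) \<in> H"
    by simp
next
  assume in_H: "proj (mmul (minv X) Y) \<in> H"
  let ?L = "mmul (minv X) Y"
  have sub: "H \<subseteq> PSL2"
    using H by (simp add: PSL2_subgroup_def)
  have "inj_on (pmul (proj ?L)) H"
  proof (rule inj_onI)
    fix g h assume "g \<in> H" "h \<in> H" and eq: "pmul (proj ?L) g = pmul (proj ?L) h"
    then obtain M N where MN: "g = proj M" "h = proj N"
      using sub unfolding PSL2_eq by blast
    have "?L \<in> SL2"
      using XY by simp
    then show "g = h"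
      using eq proj_mmul_cong[of "minv ?L" "minv ?L" "mmul ?L M" "mmul ?L N"] by (simp add: MN)
  qed
  moreover have "pmul (proj ?L) ` H \<subseteq> H"
    using H in_H by (auto simp: PSL2_subgroup_def)
  ultimately have "pmul (proj ?L) ` H = H"
    by (intro endo_inj_surj) auto
  then have "pmul (proj X) ` H = pmul (proj (mmul X ?L)) ` H"
    using pmul_proj_image[OF sub, of X ?L] by simp
  then show "pmul (proj X) ` H = pmul (proj Y) ` H"
    using XY by simp
qed

text \<open>The quotient (M X)^-1 (N X) is the conjugate of M^-1 N by \<open>X\<close>, so agreement
  at a coset becomes a question of conjugation into \<open>H\<close>.\<close>

lemma coset_perm_eq_iff:
  fixes H :: "'a::{comm_ring_1,finite} mat2 set set"
  assumes H: "PSL2_subgroup H" and "X \<in> SL2" "M \<in> SL2" "N \<in> SL2"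
  shows "coset_perm H (proj M) (pmul (proj X) ` H) = coset_perm H (proj N) (pmul (proj X) ` H) \<longleftrightarrow>
    proj (mmul (minv X) (mmul (mmul (minv M) N) X)) \<in> H"
  using assms coset_eq_iff[OF H, of "mmul M X" "mmul N X"]
  by (simp add: coset_perm_proj PSL2_subgroup_def minv_mmul mmul_assoc)

subsection \<open>Unipotent matrices\<close>

text \<open>The matrix \<open>1 + t v v\<^sup>T J\<close> with \<open>v = (x, y)\<close> and \<open>J\<close> the symplectic form;
  conjugation by \<open>g\<close> replaces \<open>v\<close> by \<open>g v\<close>, so that \<open>t\<close> modulo squares determines the conjugacy class.\<close>

definition unip :: "'a::comm_ring_1 \<Rightarrow> 'a \<Rightarrow> 'a \<Rightarrow> 'a mat2" where
  "unip t x y = (1 - t * x * y, t * x^2, - (t * y^2), 1 + t * x * y)"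

text \<open>Both signs occur because a group of order 3 contains a generator and its inverse; x = y
  = 0 puts the identity into the class.\<close>

definition unip_class :: "'a::comm_ring_1 \<Rightarrow> 'a mat2 set" where
  "unip_class s = {unip t x y | t x y. t = s \<or> t = - s}"

lemma unip_in_SL2 [simp]: "unip t x y \<in> SL2"
  by (simp add: unip_def SL2_def algebra_simps power2_eq_square)

lemma unip_0 [simp]: "unip t 0 0 = mid" "unip 0 x y = mid"
  by (simp_all add: unip_def)

lemma mmul_unip: "mmul (unip s x y) (unip t x y) = unip (s + t) x y"
  by (simp add: unip_def algebra_simps power2_eq_square)

lemma minv_unip: "minv (unip t x y) = unip (- t) x y"
  by (simp add: unip_def)

lemma mtrace_unip [simp]: "mtrace (unip t x y) = 2"
  by (simp add: unip_def)

lemma mtrace_mneg [simp]: "mtrace (mneg M) = - mtrace M"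
  by (cases M) simp

text \<open>Determinant 1 means J g^-1 = g^T J, so conjugation turns v v^T J into (g v)(g v)^T
  J.\<close>

lemma conj_unip:
  assumes "X = (a, b, c, d)" "X \<in> SL2"
  shows "mmul X (mmul (unip t x y) (minv X)) = unip t (a * x + b * y) (c * x + d * y)"
proof -
  have *: "a * d - b * c = 1"
    using assms by (simp add: SL2_def)
  have 1: "a * ((1 - t * x * y) * d + t * x^2 * - c) + b * (- (t * y^2) * d + (1 + t * x * y) * - c) =
      (a * d - b * c) - t * (a * x + b * y) * (c * x + d * y)"
    "c * ((1 - t * x * y) * - b + t * x^2 * a) + d * (- (t * y^2) * - b + (1 + t * x * y) * a) =
      (a * d - b * c) + t * (a * x + b * y) * (c * x + d * y)"
    by (simp_all add: algebra_simps power2_eq_square)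
  show ?thesis
    unfolding assms unip_def mmul.simps minv.simps prod.inject 1 *
    by (simp add: algebra_simps power2_eq_square)
qed

text \<open>M - 1 has trace and determinant 0, which gives b c = -(1 - a)^2. The vector is (1, (1 -
  a)/b) with factor b if b is nonzero, and (0, 1) with factor -c otherwise.\<close>

lemma ex_unip:
  fixes M :: "'a::field mat2"
  assumes "M \<in> SL2" "mtrace M = 2" "M \<noteq> mid"
  obtains s x y where "M = unip s x y" "s \<noteq> 0"
proof -
  obtain a b c d where M: "M = (a, b, c, d)"
    by (cases M)
  have d: "d = 2 - a"
    using assms unfolding M by (simp add: algebra_simps)
  have "a * d - b * c = 1"
    using assms unfolding M by (simp add: SL2_def)
  then have det: "b * c = - ((1 - a) ^ 2)"
    unfolding d by algebra
  show thesis
  proof (cases "b = 0")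
    case True
    then have "a = 1"
      using det by simp
    then show ?thesis
      using that[of "- c" 0 1] assms True d unfolding M by (simp add: unip_def)
  next
    case False
    then have "c = - ((1 - a) ^ 2 / b)"
      using det by (simp add: field_simps)
    then have "M = unip b 1 (- (a - 1) / b)"
      using d False unfolding M unip_def by (simp add: power2_commute power2_eq_square)
    then show ?thesis
      using that False by blast
  qed
qed

text \<open>Both vectors are completed to first columns of matrices in \<open>SL2\<close>; the
  quotient of these matrices maps one to the other.\<close>

lemma SL2_transitive:
  fixes x y x' y' :: "'a::field"
  assumes "(x, y) \<noteq> (0, 0)" "(x', y') \<noteq> (0, 0)"
  obtains a b c d where "(a, b, c, d) \<in> SL2" "a * x + b * y = x'" "c * x + d * y = y'"
proof -
  have *: "\<exists>b d. (u, b, v, d) \<in> SL2" if "(u, v) \<noteq> (0, 0)" for u v :: 'a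
  proof (cases "u = 0")
    case True
    then show ?thesis
      using that by (intro exI[of _ "- 1 / v"]) (simp add: SL2_def)
  next
    case False
    then show ?thesis
      by (intro exI[of _ 0] exI[of _ "1 / u"]) (simp add: SL2_def)
  qed
  obtain b d where 1: "(x, b, y, d) \<in> SL2"
    using * assms by blast
  obtain b' d' where 2: "(x', b', y', d') \<in> SL2"
    using * assms by blast
  have "mmul (x', b', y', d') (minv (x, b, y, d)) \<in> SL2"
    using 1 2 by (intro mmul_in_SL2 minv_in_SL2)
  moreover have "x * d - b * y = 1"
    using 1 by (simp add: SL2_def)
  ultimately show thesis
    by (intro that[of "x' * d - b' * y" "- x' * b + b' * x" "y' * d - d' * y" "- y' * b + d' * x"])
      (simp, algebra, algebra)
qed

subsection \<open>Subgroups of order three\<close>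

text \<open>Cancellation in {1, g, h} forces g h = 1 and g^2 = h. Hence g has a lift
  \<open>A\<close> with A^3 = 1, and such a lift has trace 2, so it is unipotent.\<close>

lemma subgroup_card_3_eq:
  fixes H :: "'a::{field,finite} mat2 set set"
  assumes two: "(2::'a) = - 1" and H: "PSL2_subgroup H" "card H = 3"
  obtains s x y where "s \<noteq> 0" "(x, y) \<noteq> (0, 0)"
    "H = {proj mid, proj (unip s x y), proj (unip (- s) x y)}"
proof -
  have sub: "H \<subseteq> PSL2" and one: "proj mid \<in> H" and mult: "\<And>x y. x \<in> H \<Longrightarrow> y \<in> H \<Longrightarrow> pmul x y \<in> H"
    using H by (auto simp: PSL2_subgroup_def pone_eq)
  have "card (H - {proj mid}) = 2"
    using H one by simp
  then obtain g h where gh: "H - {proj mid} = {g, h}" "g \<noteq> h"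
    by (auto simp: card_2_iff)
  then have H_eq: "H = {proj mid, g, h}" and ne: "g \<noteq> proj mid" "h \<noteq> proj mid"
    using one by auto
  have "g \<in> proj ` SL2" "h \<in> proj ` SL2"
    using sub unfolding H_eq PSL2_eq by simp_all
  then obtain M N where MN: "M \<in> SL2" "N \<in> SL2" "g = proj M" "h = proj N"
    by (metis imageE)
  have left: "proj K = proj L" if "proj (mmul M K) = proj (mmul M L)" for K L
    using that proj_mmul_cong[of "minv M" "minv M" "mmul M K" "mmul M L"] MN by simp
  have right: "proj K = proj L" if "proj (mmul K N) = proj (mmul L N)" for K L
    using that proj_mmul_cong[of "mmul K N" "mmul L N" "minv N" "minv N"] MN by (simp add: mmul_assoc)
  have "proj (mmul M N) \<in> H"
    using mult[of g h] H_eq MN by simp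
  moreover have "proj (mmul M N) \<noteq> proj M"
    using left[of N mid] ne MN by auto
  moreover have "proj (mmul M N) \<noteq> proj N"
    using right[of M mid] ne MN by auto
  ultimately have MN1: "proj (mmul M N) = proj mid"
    using H_eq MN by auto
  have "proj (mmul M M) \<in> H"
    using mult[of g g] H_eq MN by simp
  moreover have "proj (mmul M M) \<noteq> proj M"
    using left[of M mid] ne MN by auto
  moreover have "proj (mmul M M) \<noteq> proj mid"
    using left[of M N] MN1 gh MN by auto
  ultimately have MM: "proj (mmul M M) = proj N"
    using H_eq MN by auto
  then have "proj (mmul M (mmul M M)) = proj mid"
    using proj_mmul_cong[of M M "mmul M M" N] MN1 by simp
  then obtain A where A: "A \<in> SL2" "proj A = proj M" "mmul A (mmul A A) = mid"
  proof -
    assume "proj (mmul M (mmul M M)) = proj mid"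
    then consider "mmul M (mmul M M) = mid" | "mmul M (mmul M M) = mneg mid"
      unfolding proj_eq_iff by blast
    then show ?thesis
    proof cases
      case 2
      \<comment> \<open>If the cube is -1, changing the sign of the lift changes the sign of its
        cube.\<close>
      have "mneg M \<in> SL2"
        using MN by (cases M) (simp add: SL2_def)
      then show ?thesis
        by (intro that[of "mneg M"]) (auto simp: 2)
    qed (use that MN in blast)
  qed
  have "proj A \<noteq> proj mid"
    using ne(1) A(2) MN(3) by simp
  then have A_ne: "A \<noteq> mid" "A \<noteq> mneg mid"
    unfolding proj_eq_iff by blast+
  have tr: "mtrace A = 2"
  proof -
    obtain a b c d where abcd: "A = (a, b, c, d)"
      by (cases A)
    have det: "a * d - b * c = 1"
      using A by (simp add: abcd SL2_def)
    define t where "t = a + d"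
    \<comment> \<open>By Cayley-Hamilton A^2 = t A - 1, so A^3 = (t^2 - 1) A - t. Unless t^2 = 1,
      this makes \<open>A\<close> scalar, hence 1 or -1.\<close>
    have 1: "(t^2 - 1) * a - t = 1" "(t^2 - 1) * b = 0" "(t^2 - 1) * c = 0" "(t^2 - 1) * d - t = 1"
      using A(3) det unfolding abcd t_def mmul.simps prod.inject by algebra+
    have "t^2 - 1 = 0"
    proof (rule ccontr)
      assume t: "t^2 - 1 \<noteq> 0"
      then have "b = 0" "c = 0"
        using 1 by auto
      moreover have "a = d"
        using 1 t by (metis add_diff_cancel_right' diff_add_cancel mult_cancel_left)
      ultimately show False
        using det A_ne unfolding abcd by (simp flip: power2_eq_square add: power2_eq_1_iff)
    qed
    then have "t = - 1"
      using 1(1) by (simp add: minus_equation_iff)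
    then show ?thesis
      using two unfolding abcd t_def by simp
  qed
  obtain s x y where s: "A = unip s x y" "s \<noteq> 0"
    using ex_unip[OF A(1) tr A_ne(1)] .
  have "mmul A A = unip (- s) x y"
    unfolding s mmul_unip mult_2[symmetric] two by simp
  then have "proj N = proj (unip (- s) x y)"
    using MM proj_mmul_cong[OF A(2) A(2)] by simp
  then have "H = {proj mid, proj (unip s x y), proj (unip (- s) x y)}"
    using H_eq MN A s by simp
  moreover have "(x, y) \<noteq> (0, 0)"
    using A_ne s by auto
  ultimately show thesis
    using that s by blast
qed

lemma minv_conj_eq_iff:
  assumes "X \<in> SL2"
  shows "proj (mmul (minv X) (mmul L X)) = proj U \<longleftrightarrow> proj L = proj (mmul X (mmul U (minv X)))"
proof
  assume "proj (mmul (minv X) (mmul L X)) = proj U"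
  then have "proj (mmul X (mmul (mmul (minv X) (mmul L X)) (minv X))) = proj (mmul X (mmul U (minv X)))"
    by (intro proj_mmul_cong) auto
  then show "proj L = proj (mmul X (mmul U (minv X)))"
    using assms by (simp add: mmul_assoc)
next
  assume "proj L = proj (mmul X (mmul U (minv X)))"
  then have "proj (mmul (minv X) (mmul L X)) = proj (mmul (minv X) (mmul (mmul X (mmul U (minv X))) X))"
    by (intro proj_mmul_cong) auto
  then show "proj (mmul (minv X) (mmul L X)) = proj U"
    using assms by (simp add: mmul_assoc)
qed

text \<open>Conjugation keeps the factor \<open>s\<close> or \<open>- s\<close> and moves the
  vector; by \<open>SL2_transitive\<close> every nonzero vector is reached.\<close>

lemma conj_in_subgroup_iff:
  fixes s :: "'a::field"
  assumes "(x\<^sub>0, y\<^sub>0) \<noteq> (0, 0)"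
    and H: "H = {proj mid, proj (unip s x\<^sub>0 y\<^sub>0), proj (unip (- s) x\<^sub>0 y\<^sub>0)}"
  shows "(\<exists>X\<in>SL2. proj (mmul (minv X) (mmul L X)) \<in> H) \<longleftrightarrow> (\<exists>U\<in>unip_class s. proj L = proj U)"
proof
  assume "\<exists>X\<in>SL2. proj (mmul (minv X) (mmul L X)) \<in> H"
  then obtain X where X: "X \<in> SL2" "proj (mmul (minv X) (mmul L X)) \<in> H"
    by blast
  have "\<exists>t x y. (t = s \<or> t = - s) \<and> proj (mmul (minv X) (mmul L X)) = proj (unip t x y)"
  proof -
    \<comment> \<open>The identity is written as \<open>unip s 0 0\<close> to give all three members
      of \<open>H\<close> the same form.\<close>
    from X(2) consider "proj (mmul (minv X) (mmul L X)) = proj (unip s 0 0)"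
      | "proj (mmul (minv X) (mmul L X)) = proj (unip s x\<^sub>0 y\<^sub>0)"
      | "proj (mmul (minv X) (mmul L X)) = proj (unip (- s) x\<^sub>0 y\<^sub>0)"
      unfolding H by auto
    then show ?thesis
      by cases blast+
  qed
  then obtain t x y where t: "t = s \<or> t = - s" "proj (mmul (minv X) (mmul L X)) = proj (unip t x y)"
    by blast
  obtain a b c d where abcd: "X = (a, b, c, d)"
    by (cases X)
  have "proj L = proj (unip t (a * x + b * y) (c * x + d * y))"
    using t(2) minv_conj_eq_iff[OF X(1)] conj_unip[OF abcd X(1)] by simp
  then show "\<exists>U\<in>unip_class s. proj L = proj U"
    using t(1) unfolding unip_class_def by blast
next
  assume "\<exists>U\<in>unip_class s. proj L = proj U"
  then obtain t x y where t: "t = s \<or> t = - s" and L: "proj L = proj (unip t x y)"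
    unfolding unip_class_def by blast
  show "\<exists>X\<in>SL2. proj (mmul (minv X) (mmul L X)) \<in> H"
  proof (cases "(x, y) = (0, 0)")
    case True
    then have "proj (mmul (minv mid) (mmul L mid)) \<in> H"
      using L unfolding H by simp
    then show ?thesis
      by (rule bexI) simp
  next
    case False
    then obtain a b c d where X: "(a, b, c, d) \<in> SL2" "a * x\<^sub>0 + b * y\<^sub>0 = x" "c * x\<^sub>0 + d * y\<^sub>0 = y"
      using SL2_transitive[OF assms(1)] by metis
    have "proj (mmul (minv (a, b, c, d)) (mmul L (a, b, c, d))) = proj (unip t x\<^sub>0 y\<^sub>0)"
      using L minv_conj_eq_iff[OF X(1)] conj_unip[OF refl X(1), of t x\<^sub>0 y\<^sub>0] X(2,3) by simp
    then show ?thesis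
      using t X(1) unfolding H by (intro bexI[of _ "(a, b, c, d)"]) auto
  qed
qed

subsection \<open>Sets of unipotent matrices with unipotent quotients\<close>

text \<open>For unipotent U = 1 + E and V = 1 + F this is the trace form tr (E F), since U^-1 = 1 -
  E.\<close>

definition quad :: "'a::comm_ring_1 mat2 \<Rightarrow> 'a mat2 \<Rightarrow> 'a" where
  "quad U V = 2 - mtrace (mmul (minv U) V)"

lemma quad_unip: "quad (unip t x y) (unip t' x' y') = - (t * t' * (x * y' - y * x')^2)"
  by (simp add: quad_def unip_def algebra_simps power2_eq_square)

lemma quad_trace_2:
  "quad (1 + p, q, r, 1 - p) (1 + p', q', r', 1 - p') = 2 * p * p' + q * r' + r * q'"
  by (simp add: quad_def algebra_simps)

lemma unip_scale: "unip t (m * x) (m * y) = unip (t * m^2) x y"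
  by (simp add: unip_def algebra_simps power2_eq_square)

text \<open>The vanishing cross product makes the two vectors proportional, and the square of the
  ratio moves into the factor.\<close>

lemma quad_unip_eq_0D:
  fixes t :: "'a::field"
  assumes "quad (unip t x y) (unip t' x' y') = 0" "t \<noteq> 0" "t' \<noteq> 0" "(x, y) \<noteq> (0, 0)"
  shows "\<exists>l. unip t' x' y' = unip (l * t) x y"
proof -
  have xy: "x * y' = y * x'"
    using assms by (simp add: quad_unip)
  have "\<exists>m. x' = m * x \<and> y' = m * y"
  proof (cases "x = 0")
    case True
    then show ?thesis
      using xy assms(4) by (intro exI[of _ "y' / y"]) simp
  next
    case False
    then show ?thesis
      using xy by (intro exI[of _ "x' / x"]) (simp add: field_simps)
  qed
  then obtain m where "unip t' x' y' = unip (t' * m^2) x y"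
    using unip_scale by metis
  then show ?thesis
    using assms(2) by (intro exI[of _ "t' * m^2 / t"]) simp
qed

text \<open>The Gram matrix of the three vectors has diagonal 0 and all other entries 1, so its
  determinant is 2. It also equals -2 D^2 with \<open>D\<close> their coordinate determinant, so
  they form a basis.\<close>

lemma orthogonal_to_basis_eq_0:
  fixes p q r :: "'a::idom"
  assumes "(2::'a) \<noteq> 0"
    and iso: "p1^2 + q1 * r1 = 0" "p2^2 + q2 * r2 = 0" "p3^2 + q3 * r3 = 0"
    and one: "2 * p1 * p2 + q1 * r2 + r1 * q2 = 1" "2 * p1 * p3 + q1 * r3 + r1 * q3 = 1"
      "2 * p2 * p3 + q2 * r3 + r2 * q3 = 1"
    and orth: "2 * p1 * p + q1 * r + r1 * q = 0" "2 * p2 * p + q2 * r + r2 * q = 0"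
      "2 * p3 * p + q3 * r + r3 * q = 0"
  shows "p = 0 \<and> q = 0 \<and> r = 0"
proof -
  define D where "D = p1 * (q2 * r3 - r2 * q3) - q1 * (p2 * r3 - r2 * p3) + r1 * (p2 * q3 - q2 * p3)"
  let ?g11 = "2 * (p1^2 + q1 * r1)" and ?g22 = "2 * (p2^2 + q2 * r2)" and ?g33 = "2 * (p3^2 + q3 * r3)"
  let ?g12 = "2 * p1 * p2 + q1 * r2 + r1 * q2" and ?g13 = "2 * p1 * p3 + q1 * r3 + r1 * q3"
  let ?g23 = "2 * p2 * p3 + q2 * r3 + r2 * q3"
  have "- 2 * D^2 = ?g11 * (?g22 * ?g33 - ?g23^2) - ?g12 * (?g12 * ?g33 - ?g23 * ?g13)
      + ?g13 * (?g12 * ?g23 - ?g22 * ?g13)"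
    unfolding D_def by algebra
  also have "\<dots> = 2"
    unfolding iso one by simp
  finally have "D \<noteq> 0"
    using assms(1) by auto
  \<comment> \<open>Cramer's rule for the three orthogonality equations.\<close>
  moreover have "2 * D * p = 0" "D * q = 0" "D * r = 0"
    using orth unfolding D_def by algebra+
  ultimately show ?thesis
    using assms(1) by simp
qed

lemma two_minus_minus_two:
  assumes "(2::'a::comm_ring_1) = - 1"
  shows "2 - - 2 = (1::'a)"
proof -
  have "2 - - 2 = 2 * (2::'a)"
    by simp
  also have "\<dots> = 1"
    unfolding assms by simp
  finally show ?thesis .
qed

lemma unip_classE:
  assumes "U \<in> unip_class s" "s \<noteq> 0"
  obtains t x y where "U = unip t x y" "t = s \<or> t = - s" "t \<noteq> 0"
  using assms unfolding unip_class_def by auto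

lemma unip_traceless:
  obtains p q r where "unip t x y = (1 + p, q, r, 1 - p)" "p^2 + q * r = 0"
proof
  show "unip t x y = (1 + - (t * x * y), t * x^2, - (t * y^2), 1 - - (t * x * y))"
    by (simp add: unip_def)
  show "(- (t * x * y))^2 + t * x^2 * - (t * y^2) = 0"
    by (simp add: power2_eq_square)
qed

lemma unipotent_clique:
  fixes S :: "'a::field mat2 set"
  assumes two: "(2::'a) = - 1" and s: "s \<noteq> 0" and S: "finite S" "S \<subseteq> unip_class s"
    and pair: "\<And>U V. U \<in> S \<Longrightarrow> V \<in> S \<Longrightarrow> \<exists>W\<in>unip_class s. proj (mmul (minv U) V) = proj W"
  shows "card S \<le> 5 \<or> (\<exists>t x y. (t = s \<or> t = - s) \<and> (x, y) \<noteq> (0, 0) \<and>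
    (\<forall>V\<in>S. \<exists>l. V = unip (l * t) x y))"
proof -
  have two_ne: "(2::'a) \<noteq> 0"
    unfolding two by simp
  have quad_01: "quad U V = 0 \<or> quad U V = 1" if UV: "U \<in> S" "V \<in> S" for U V
  proof -
    obtain W where "W \<in> unip_class s" "mmul (minv U) V = W \<or> mmul (minv U) V = mneg W"
      using pair[OF UV] unfolding proj_eq_iff by blast
    then have "mtrace (mmul (minv U) V) = 2 \<or> mtrace (mmul (minv U) V) = - 2"
      unfolding unip_class_def by auto
    then show ?thesis
      unfolding quad_def using two_minus_minus_two[OF two] by (metis diff_self)
  qed
  show ?thesis
  \<comment> \<open>The identity is left out because \<open>quad\<close> vanishes on it.\<close>
  proof (cases "\<exists>U\<in>S - {mid}. \<exists>V\<in>S - {mid}. U \<noteq> V \<and> quad U V = 0")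
    case True
    then obtain U V where UV: "U \<in> S" "U \<noteq> mid" "V \<in> S" "V \<noteq> mid" "U \<noteq> V" "quad U V = 0"
      by blast
    obtain t x y where U: "U = unip t x y" "t = s \<or> t = - s" "t \<noteq> 0"
      using unip_classE S UV(1) s by blast
    have xy: "(x, y) \<noteq> (0, 0)"
      using UV(2) U(1) by auto
    have proportional: "\<exists>l. W = unip (l * t) x y" if W: "W \<in> S" "quad U W = 0" for W
    proof -
      obtain t' x' y' where "W = unip t' x' y'" "t' \<noteq> 0"
        using unip_classE S W(1) s by blast
      then show ?thesis
        using quad_unip_eq_0D[of t x y t' x' y'] W(2) U xy by simp
    qed
    obtain l where l: "V = unip (l * t) x y"
      using proportional UV by blast
    have l01: "l \<noteq> 0" "l \<noteq> 1"
      using l UV U by auto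
    have "quad U W = 0" if WS: "W \<in> S" for W
    proof -
      obtain t' x' y' where W: "W = unip t' x' y'"
        using unip_classE S WS s by blast
      \<comment> \<open>Both values lie in {0, 1}; as l is neither 0 nor 1, \<open>quad U W\<close>
        cannot be 1.\<close>
      have "quad V W = l * quad U W"
        unfolding l W U(1) quad_unip by simp
      then show ?thesis
        using quad_01[OF UV(1) WS] quad_01[OF UV(3) WS] l01 by auto
    qed
    then show ?thesis
      using proportional U xy by blast
  next
    case False
    define T where "T = S - {mid}"
    have T1: "quad U V = 1" if "U \<in> T" "V \<in> T" "U \<noteq> V" for U V
      using False quad_01 that unfolding T_def by blast
    have "finite T"
      using S by (simp add: T_def)
    have "card T \<le> 4"
    proof (rule ccontr)
      assume "\<not> card T \<le> 4"
      then obtain R where R: "R \<subseteq> T" "card R = 3" "finite R"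
        using obtain_subset_with_card_n[of 3 T] by auto
      then obtain U1 U2 U3 where U: "R = {U1, U2, U3}" "U1 \<noteq> U2" "U1 \<noteq> U3" "U2 \<noteq> U3"
        by (auto simp: card_3_iff)
      have form: "\<exists>p q r. U = (1 + p, q, r, 1 - p) \<and> p^2 + q * r = 0" if UT: "U \<in> T" for U
      proof -
        obtain t x y where "U = unip t x y"
          using unip_classE S UT s unfolding T_def by blast
        then show ?thesis
          using unip_traceless by metis
      qed
      have mem: "U1 \<in> T" "U2 \<in> T" "U3 \<in> T"
        using U(1) R(1) by simp_all
      obtain p1 q1 r1 where 1: "U1 = (1 + p1, q1, r1, 1 - p1)" "p1^2 + q1 * r1 = 0"
        using form[OF mem(1)] by blast
      obtain p2 q2 r2 where 2: "U2 = (1 + p2, q2, r2, 1 - p2)" "p2^2 + q2 * r2 = 0"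
        using form[OF mem(2)] by blast
      obtain p3 q3 r3 where 3: "U3 = (1 + p3, q3, r3, 1 - p3)" "p3^2 + q3 * r3 = 0"
        using form[OF mem(3)] by blast
      \<comment> \<open>The difference of two further members is orthogonal to the basis given by
        \<open>R\<close>, so there is at most one member outside \<open>R\<close>.\<close>
      have "V = W" if VW: "V \<in> T - R" "W \<in> T - R" for V W
      proof -
        obtain p q r where V: "V = (1 + p, q, r, 1 - p)"
          using form VW(1) by blast
        obtain p' q' r' where W: "W = (1 + p', q', r', 1 - p')"
          using form VW(2) by blast
        have "quad U1 V = 1" "quad U2 V = 1" "quad U3 V = 1" "quad U1 W = 1" "quad U2 W = 1" "quad U3 W = 1"
          using T1 VW mem unfolding U(1) by (metis DiffE insertCI)+
        then have orth: "2 * p1 * (p - p') + q1 * (r - r') + r1 * (q - q') = 0"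
          "2 * p2 * (p - p') + q2 * (r - r') + r2 * (q - q') = 0"
          "2 * p3 * (p - p') + q3 * (r - r') + r3 * (q - q') = 0"
          unfolding V W 1 2 3 quad_trace_2 by algebra+
        have "quad U1 U2 = 1" "quad U1 U3 = 1" "quad U2 U3 = 1"
          using T1 mem U(2-4) by metis+
        then have "p - p' = 0 \<and> q - q' = 0 \<and> r - r' = 0"
          unfolding 1 2 3 quad_trace_2
          by (rule orthogonal_to_basis_eq_0[OF two_ne 1(2) 2(2) 3(2) _ _ _ orth])
        then show ?thesis
          unfolding V W by simp
      qed
      then have "card (T - R) \<le> Suc 0"
        using \<open>finite T\<close> by (subst card_le_Suc0_iff_eq) auto
      then show False
        using R \<open>\<not> card T \<le> 4\<close> \<open>finite T\<close> by (simp add: card_Diff_subset)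
    qed
    then have "card S \<le> 5"
      unfolding T_def using S by (cases "mid \<in> S") (auto simp: card_Diff_singleton)
    then show ?thesis
      by blast
  qed
qed

lemma proj_minv_cong: "proj M = proj N \<Longrightarrow> proj (minv M) = proj (minv N)"
  by (cases M; cases N) (auto simp: proj_eq_iff)

text \<open>Unipotent lifts are unique: their trace is 2, that of a negative is -2, and these
  differ.\<close>

lemma proj_unip_eq_iff:
  assumes "(2::'a::comm_ring_1) = - 1"
  shows "proj (unip t x y) = proj (unip t' x' y' :: 'a mat2) \<longleftrightarrow> unip t x y = unip t' x' y'"
proof -
  have "unip t x y \<noteq> mneg (unip t' x' y')"
  proof
    assume "unip t x y = mneg (unip t' x' y')"
    then have "mtrace (unip t x y) = - mtrace (unip t' x' y')"
      by simp
    then have "(2::'a) = - 2"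
      unfolding mtrace_unip .
    then show False
      using two_minus_minus_two[OF assms] by (metis diff_self zero_neq_one)
  qed
  then show ?thesis
    by (auto simp: proj_eq_iff)
qed

section \<open>The action on the cosets of a subgroup of order three\<close>

locale order_3_subgroup =
  fixes H :: "'a::{field,finite} mat2 set set" and s x\<^sub>0 y\<^sub>0 :: 'a
  assumes two: "(2::'a) = - 1"
    and H: "PSL2_subgroup H" "card H = 3"
    and s: "s \<noteq> 0" and v\<^sub>0: "(x\<^sub>0, y\<^sub>0) \<noteq> (0, 0)"
    and H_eq: "H = {proj mid, proj (unip s x\<^sub>0 y\<^sub>0), proj (unip (- s) x\<^sub>0 y\<^sub>0)}"
begin

lemma coset_perm_agree_iff:
  assumes "M \<in> SL2" "N \<in> SL2"
  shows "(\<exists>v\<in>left_cosets H. coset_perm H (proj M) v = coset_perm H (proj N) v) \<longleftrightarrow>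
    (\<exists>U\<in>unip_class s. proj (mmul (minv M) N) = proj U)"
  unfolding left_cosets_eq bex_simps(7) using assms
  by (simp add: coset_perm_eq_iff[OF H(1)] conj_in_subgroup_iff[OF v\<^sub>0 H_eq, symmetric])

text \<open>If L = M^-1 N acts trivially, all its conjugates lie in \<open>H\<close>. A nontrivial
  \<open>L\<close> has a conjugate belonging to a vector not proportional to that of
  \<open>H\<close>.\<close>

lemma coset_perm_faithful:
  assumes MN: "M \<in> SL2" "N \<in> SL2" and eq: "coset_perm H (proj M) = coset_perm H (proj N)"
  shows "proj M = proj N"
proof -
  define L where "L = mmul (minv M) N"
  have conj: "proj (mmul (minv X) (mmul L X)) \<in> H" if "X \<in> SL2" for X
    unfolding L_def using coset_perm_eq_iff[OF H(1) that MN] eq by simp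
  have "proj L = proj mid"
  proof (rule ccontr)
    assume "proj L \<noteq> proj mid"
    then obtain t where t: "t = s \<or> t = - s" "proj L = proj (unip t x\<^sub>0 y\<^sub>0)"
      using conj[of mid] unfolding H_eq by auto
    \<comment> \<open>A coordinate vector off the line of \<open>(x\<^sub>0, y\<^sub>0)\<close>: its
      zero coordinate will force t' = 0, and its other coordinate then t = 0.\<close>
    define x y :: 'a where "x = (if x\<^sub>0 = 0 then 1 else 0)" and "y = (if x\<^sub>0 = 0 then 0 else 1)"
    then have "(x, y) \<noteq> (0, 0)"
      by simp
    then obtain a b c d where Y: "(a, b, c, d) \<in> SL2" "a * x\<^sub>0 + b * y\<^sub>0 = x" "c * x\<^sub>0 + d * y\<^sub>0 = y"
      using SL2_transitive[OF v\<^sub>0] by metis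
    define Y' where "Y' = minv (a, b, c, d)"
    have Y': "Y' \<in> SL2" "minv Y' = (a, b, c, d)"
      using Y(1) unfolding Y'_def by (auto simp: SL2_def algebra_simps)
    have "proj (mmul (minv Y') (mmul L Y')) = proj (unip t x y)"
      using conj_unip[OF refl Y(1), of t x\<^sub>0 y\<^sub>0] t(2) Y(2,3)
        proj_mmul_cong[OF refl, OF proj_mmul_cong[OF t(2) refl], of "minv Y'" Y'] Y'(2)
      by (simp add: Y'_def)
    then have "proj (unip t x y) \<in> H"
      using conj[OF Y'(1)] by simp
    then obtain t' where t': "t' = 0 \<or> t' = s \<or> t' = - s" "unip t x y = unip t' x\<^sub>0 y\<^sub>0"
      unfolding H_eq using proj_unip_eq_iff[OF two, of t x y] by (metis insertE singletonD unip_0(2))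
    then have "t * x^2 = t' * x\<^sub>0^2" "t * y^2 = t' * y\<^sub>0^2"
      by (auto simp: unip_def)
    then show False
      using t(1) t'(1) s v\<^sub>0 by (auto simp: x_def y_def split: if_splits)
  qed
  then have "proj (mmul M L) = proj (mmul M mid)"
    by (rule proj_mmul_cong[OF refl])
  then show ?thesis
    using MN unfolding L_def by simp
qed

text \<open>The stabilizer of the coset of \<open>X\<close> is induced by X H X^-1, and faithfulness
  keeps its three elements distinct.\<close>

lemma card_stabilizer:
  assumes "v \<in> left_cosets H"
  shows "card (stabilizer (coset_action_group H) v) = 3"
proof -
  obtain X where X: "X \<in> SL2" "v = pmul (proj X) ` H"
    using assms unfolding left_cosets_eq by blast
  have sub: "H \<subseteq> proj ` SL2"
    using H(1) unfolding PSL2_subgroup_def PSL2_eq by blast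
  have fix_iff: "coset_perm H (proj M) v = v \<longleftrightarrow> proj (mmul (minv X) (mmul M X)) \<in> H" if "M \<in> SL2" for M
    using coset_perm_eq_iff[OF H(1) X(1) mid_in_SL2 that] coset_perm_proj[of H X mid] H(1) X
    by (auto simp: PSL2_subgroup_def)
  define \<phi> where "\<phi> h = coset_perm H (pmul (proj X) (pmul h (proj (minv X))))" for h
  have \<phi>: "\<phi> (proj K) = coset_perm H (proj (mmul X (mmul K (minv X))))" for K
    by (simp add: \<phi>_def)
  have "stabilizer (coset_action_group H) v = \<phi> ` H"
  proof (intro equalityI subsetI)
    fix g assume "g \<in> stabilizer (coset_action_group H) v"
    then obtain M where M: "M \<in> SL2" "g = coset_perm H (proj M)" "coset_perm H (proj M) v = v"
      unfolding stabilizer_def coset_action_group_def PSL2_eq by blast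
    have "g = \<phi> (proj (mmul (minv X) (mmul M X)))"
      using M X(1) by (simp add: \<phi> mmul_assoc)
    then show "g \<in> \<phi> ` H"
      using fix_iff M by blast
  next
    fix g assume "g \<in> \<phi> ` H"
    then obtain K where K: "K \<in> SL2" "proj K \<in> H" "g = \<phi> (proj K)"
      using sub by blast
    let ?M = "mmul X (mmul K (minv X))"
    have M: "?M \<in> SL2"
      using K X by simp
    have "coset_perm H (proj ?M) v = v"
      using K X(1) by (simp add: fix_iff[OF M] mmul_assoc)
    then show "g \<in> stabilizer (coset_action_group H) v"
      using M unfolding stabilizer_def coset_action_group_def PSL2_eq K(3) \<phi> by blast
  qed
  moreover have "inj_on \<phi> H"
  proof (rule inj_onI)
    fix g h assume gh: "g \<in> H" "h \<in> H" "\<phi> g = \<phi> h"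
    obtain K where K: "K \<in> SL2" "g = proj K"
      using sub gh(1) by blast
    obtain L where L: "L \<in> SL2" "h = proj L"
      using sub gh(2) by blast
    have "proj (mmul X (mmul K (minv X))) = proj (mmul X (mmul L (minv X)))"
      using gh(3) K L X(1) by (intro coset_perm_faithful) (simp_all add: \<phi>)
    then have "proj (mmul (minv X) (mmul (mmul X (mmul K (minv X))) X)) =
        proj (mmul (minv X) (mmul (mmul X (mmul L (minv X))) X))"
      by (rule proj_mmul_cong[OF refl proj_mmul_cong[OF _ refl]])
    then show "g = h"
      using K L X(1) by (simp add: mmul_assoc)
  qed
  ultimately show ?thesis
    using H(2) by (simp add: card_image)
qed

lemma card_intersecting_le:
  assumes n: "n \<ge> 3" and q: "CARD('a) = 3 ^ n"
    and F: "F \<subseteq> coset_action_group H" "intersecting (left_cosets H) F"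
  shows "card F \<le> (if odd n then 3 ^ n else 3 ^ (n div 2))" (is "_ \<le> ?k")
proof (cases "F = {}")
  case False
  define f where "f M = coset_perm H (proj M)" for M
  have "F \<subseteq> f ` SL2"
    using F(1) unfolding coset_action_group_def PSL2_eq f_def image_image .
  \<comment> \<open>\<open>B\<close> contains one matrix for each permutation in \<open>F\<close>;
    dividing by \<open>M0\<close> and correcting signs by \<open>e\<close> will make these
    unipotent.\<close>
  then obtain B where B: "B \<subseteq> SL2" "inj_on f B" "F = f ` B"
    unfolding subset_image_inj by blast
  then obtain M0 where M0: "M0 \<in> B" "M0 \<in> SL2"
    using False by blast
  have agree: "\<exists>U\<in>unip_class s. proj (mmul (minv M) N) = proj U" if "M \<in> B" "N \<in> B" for M N
    using F(2) that B coset_perm_agree_iff[of M N] unfolding intersecting_def f_def by blast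
  then have "\<exists>e. \<forall>M\<in>B. e M \<in> unip_class s \<and> proj (mmul (minv M0) M) = proj (e M)"
    using M0 by (intro bchoice) blast
  then obtain e where e: "\<And>M. M \<in> B \<Longrightarrow> e M \<in> unip_class s"
      "\<And>M. M \<in> B \<Longrightarrow> proj (mmul (minv M0) M) = proj (e M)"
    by blast
  define S where "S = e ` B"
  have "inj_on e B"
  proof (rule inj_onI)
    fix M N assume MN: "M \<in> B" "N \<in> B" "e M = e N"
    then have "proj (mmul (minv M0) M) = proj (mmul (minv M0) N)"
      using e(2) by simp
    then have "proj (mmul M0 (mmul (minv M0) M)) = proj (mmul M0 (mmul (minv M0) N))"
      by (rule proj_mmul_cong[OF refl])
    then have "f M = f N"
      using M0 by (simp add: f_def)
    then show "M = N"
      using B(2) MN inj_onD by metis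
  qed
  then have card_F: "card F = card S"
    using B by (simp add: S_def card_image)
  have pair: "\<exists>W\<in>unip_class s. proj (mmul (minv U) V) = proj W" if "U \<in> S" "V \<in> S" for U V
  proof -
    obtain M N where MN: "M \<in> B" "N \<in> B" "U = e M" "V = e N"
      using \<open>U \<in> S\<close> \<open>V \<in> S\<close> unfolding S_def by blast
    have "proj (mmul (minv U) V) = proj (mmul (minv (mmul (minv M0) M)) (mmul (minv M0) N))"
      using e(2) MN by (intro proj_mmul_cong proj_minv_cong) simp_all
    also have "mmul (minv (mmul (minv M0) M)) (mmul (minv M0) N) = mmul (minv M) N"
      using M0 by (simp add: minv_mmul mmul_assoc)
    finally show ?thesis
      using agree MN by simp
  qed
  \<comment> \<open>Here n >= 3 enters: the bound is at least 27 for odd and 9 for even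
    \<open>n\<close>, which covers the sporadic cliques.\<close>
  have five: "5 \<le> ?k"
  proof (cases "odd n")
    case True
    have "(3::nat) ^ 3 \<le> 3 ^ n"
      using n by (intro power_increasing) auto
    then show ?thesis
      using True by simp
  next
    case False
    then have "2 \<le> n div 2"
      using n by presburger
    then have "(3::nat) ^ 2 \<le> 3 ^ (n div 2)"
      by (intro power_increasing) auto
    then show ?thesis
      using False by simp
  qed
  have "S \<subseteq> unip_class s"
    using e(1) unfolding S_def by blast
  then have "card S \<le> 5 \<or> (\<exists>t x y. (t = s \<or> t = - s) \<and> (x, y) \<noteq> (0, 0) \<and>
      (\<forall>V\<in>S. \<exists>l. V = unip (l * t) x y))"
    by (intro unipotent_clique[OF two s _ _ pair]) simp_all
  then consider "card S \<le> 5"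
    | t x y where "t = s \<or> t = - s" "(x, y) \<noteq> (0, 0)" "\<forall>V\<in>S. \<exists>l. V = unip (l * t) x y"
    by blast
  then show ?thesis
  proof cases
    case 1
    then show ?thesis
      using five card_F by linarith
  next
    case 2
    define C where "C = {l. unip (l * t) x y \<in> S}"
    have "S \<subseteq> (\<lambda>l. unip (l * t) x y) ` C"
    proof
      fix V assume "V \<in> S"
      moreover obtain l where "V = unip (l * t) x y"
        using 2(3) \<open>V \<in> S\<close> by blast
      ultimately show "V \<in> (\<lambda>l. unip (l * t) x y) ` C"
        unfolding C_def by simp
    qed
    then have S_le: "card S \<le> card C"
      by (intro surj_card_le) auto
    show ?thesis
    proof (cases "odd n")
      case True
      have "card C \<le> CARD('a)"
        by (rule card_mono) auto
      then show ?thesis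
        using S_le card_F q True by simp
    next
      case False
      have "is_sqr (- 1 :: 'a)"
        using square_subfield[OF q] False n by (metis gr0I not_numeral_le_zero)
      moreover have "is_sqr (1 :: 'a)"
        unfolding is_sqr_def by (metis one_power2)
      ultimately have "is_sqr (a - b)" if ab: "a \<in> C" "b \<in> C" for a b
      proof -
        obtain t' x' y' where t': "t' = s \<or> t' = - s"
            "proj (mmul (minv (unip (b * t) x y)) (unip (a * t) x y)) = proj (unip t' x' y')"
          using pair[of "unip (b * t) x y" "unip (a * t) x y"] ab unfolding C_def unip_class_def by blast
        then have "unip ((a - b) * t) x y = unip t' x' y'"
          by (simp add: minv_unip mmul_unip proj_unip_eq_iff[OF two] algebra_simps)
        then have "(a - b) * t * x^2 = t' * x'^2" "(a - b) * t * y^2 = t' * y'^2"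
          by (auto simp: unip_def)
        then have "(a - b) * x^2 = t' / t * x'^2" "(a - b) * y^2 = t' / t * y'^2"
          using 2(1) s by (auto simp: field_simps)
        \<comment> \<open>Used with \<open>z\<close> a nonzero coordinate of the vector; the factor
          t'/t is 1 or -1, a square for even \<open>n\<close>.\<close>
        moreover have "a - b = c * (w / z)^2" if "(a - b) * z^2 = c * w^2" "z \<noteq> 0" for c w z
          using that by (simp add: power_divide eq_divide_eq)
        ultimately have "a - b = t' / t * (x' / x)^2 \<or> a - b = t' / t * (y' / y)^2"
          using 2(2) by blast
        moreover have "is_sqr (t' / t)"
          using \<open>is_sqr (- 1)\<close> \<open>is_sqr 1\<close> t'(1) 2(1) s by auto
        ultimately show ?thesis
          using is_sqr_mult is_sqr_def by metis
      qed
      then have "card C ^ 2 \<le> (3 ^ (n div 2)) ^ 2"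
        using card_square_difference_clique[of C] two False q by (simp flip: power_mult)
      then have "card C \<le> 3 ^ (n div 2)"
        by (rule power2_le_imp_le) simp
      then show ?thesis
        using S_le card_F False by simp
    qed
  qed
qed simp

lemma ex_intersecting:
  assumes n: "n \<ge> 3" and q: "CARD('a) = 3 ^ n"
  obtains F where "F \<subseteq> coset_action_group H" "intersecting (left_cosets H) F"
    "card F = (if odd n then 3 ^ n else 3 ^ (n div 2))"
proof -
  obtain K :: "'a set" where K: "card K = (if odd n then 3 ^ n else 3 ^ (n div 2))"
    "\<And>a b. a \<in> K \<Longrightarrow> b \<in> K \<Longrightarrow> is_sqr (a - b) \<or> is_sqr (- 1 * (a - b))"
  proof (cases "odd n")
    case True
    show ?thesis
    proof (rule that[of UNIV])
      show "is_sqr (a - b) \<or> is_sqr (- 1 * (a - b))" for a b :: 'a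
        using not_is_sqr_minus_1[OF q True] by (rule is_sqr_or_is_sqr_mult)
    qed (use q True in simp)
  next
    case False
    then obtain K :: "'a set" where "card K = 3 ^ (n div 2)"
        "\<And>x y. x \<in> K \<Longrightarrow> y \<in> K \<Longrightarrow> x - y \<in> K" "\<And>x. x \<in> K \<Longrightarrow> is_sqr x"
      using square_subfield[OF q] n by (metis gr0I not_numeral_le_zero)
    then show ?thesis
      using that[of K] False by auto
  qed
  define f where "f k = coset_perm H (proj (unip (s * k) 1 0))" for k
  have "f ` K \<subseteq> coset_action_group H"
    unfolding f_def coset_action_group_def PSL2_eq by auto
  moreover have "intersecting (left_cosets H) (f ` K)"
    unfolding intersecting_def f_def
  proof (intro ballI, elim imageE, hypsubst)
    fix a b assume "a \<in> K" "b \<in> K"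
    \<comment> \<open>The sign in the choice of \<open>K\<close> is absorbed by choosing between
      \<open>s\<close> and \<open>- s\<close>.\<close>
    have "\<exists>t z. (t = s \<or> t = - s) \<and> s * (b - a) = t * z^2"
      using K(2)[OF \<open>b \<in> K\<close> \<open>a \<in> K\<close>] unfolding is_sqr_def
      by (metis minus_mult_commute mult_minus1 mult_minus_left minus_minus)
    then obtain t z where t: "t = s \<or> t = - s" "s * (b - a) = t * z^2"
      by blast
    have "mmul (minv (unip (s * a) 1 0)) (unip (s * b) 1 0) = unip (s * (b - a)) 1 0"
      by (simp add: minv_unip mmul_unip algebra_simps)
    also have "\<dots> = unip t z 0"
      unfolding t(2) by (simp add: unip_def)
    finally have "mmul (minv (unip (s * a) 1 0)) (unip (s * b) 1 0) \<in> unip_class s"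
      using t(1) unfolding unip_class_def by blast
    then show "\<exists>v\<in>left_cosets H. coset_perm H (proj (unip (s * a) 1 0)) v = coset_perm H (proj (unip (s * b) 1 0)) v"
      by (subst coset_perm_agree_iff) auto
  qed
  moreover have "inj_on f K"
  proof (rule inj_onI)
    fix a b assume "f a = f b"
    then have "proj (unip (s * a) 1 0) = proj (unip (s * b) 1 0)"
      unfolding f_def by (rule coset_perm_faithful[rotated 2]) simp_all
    then show "a = b"
      unfolding proj_unip_eq_iff[OF two] using s by (simp add: unip_def)
  qed
  ultimately show thesis
    using that[of "f ` K"] K(1) by (simp add: card_image)
qed

end

section \<open>The intersection density\<close>

theorem theorem7p2:
  fixes H :: "'a::{field,finite} mat2 set set" and n :: nat
  assumes "n \<ge> 3"
    and "CARD('a) = 3 ^ n"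
    and "PSL2_subgroup H"
    and "card H = 3"
  shows "intersection_density (coset_action_group H) (left_cosets H) =
           (if odd n then 3 ^ (n - 1) else 3 ^ (n div 2 - 1))"
proof -
  have two: "(2::'a) = - 1"
    using two_eq_minus_1 assms(2) .
  obtain s x y where "s \<noteq> 0" "(x, y) \<noteq> (0, 0)"
    "H = {proj mid, proj (unip s x y), proj (unip (- s) x y)}"
    using subgroup_card_3_eq[OF two assms(3,4)] by metis
  then interpret order_3_subgroup H s x y
    using two assms by unfold_locales
  let ?V = "left_cosets H" and ?k = "if odd n then 3 ^ n else 3 ^ (n div 2) :: nat"
  have "?V \<noteq> {}"
    unfolding left_cosets_eq using mid_in_SL2 by blast
  \<comment> \<open>All point stabilizers have order 3, so the inner maximum is 3 and only the
    largest intersecting set remains to be found.\<close>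
  then have "(\<lambda>v. card (stabilizer (coset_action_group H) v)) ` ?V = {3}"
    using card_stabilizer by auto
  then have "intersection_density (coset_action_group H) ?V =
      Max {real (card F) / 3 | F. F \<subseteq> coset_action_group H \<and> intersecting ?V F}"
    by (simp add: intersection_density_def)
  also have "\<dots> = real ?k / 3"
  proof (rule Max_eqI)
    show "finite {real (card F) / 3 | F. F \<subseteq> coset_action_group H \<and> intersecting ?V F}"
      by (intro finite_image_set finite)
    show "r \<le> real ?k / 3" if r: "r \<in> {real (card F) / 3 | F. F \<subseteq> coset_action_group H \<and> intersecting ?V F}" for r
    proof -
      obtain F where F: "r = real (card F) / 3" "F \<subseteq> coset_action_group H" "intersecting ?V F"
        using r by blast
      then have "real (card F) \<le> real ?k"
        using card_intersecting_le[OF assms(1,2)] of_nat_le_iff by blast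
      then show ?thesis
        unfolding F(1) by (rule divide_right_mono) simp
    qed
    obtain F where "F \<subseteq> coset_action_group H" "intersecting ?V F" "card F = ?k"
      using ex_intersecting[OF assms(1,2)] .
    then show "real ?k / 3 \<in> {real (card F) / 3 | F. F \<subseteq> coset_action_group H \<and> intersecting ?V F}"
      by (intro CollectI exI[of _ F]) simp
  qed
  also have "\<dots> = (if odd n then 3 ^ (n - 1) else 3 ^ (n div 2 - 1))"
    using assms(1) by (simp add: power_diff)
  finally show ?thesis .
qed

end
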